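(* Let $\mathbb{H}$ be a nonzero Hilbert space and let $G$ be a group acting on $\mathbb{H}$ by continuous linear maps without fixed points except the origin. Let $g\in G$ be an element of finite order and let $m\in C(g)$ be an element of finite order of the centralizer $C(g)$ of $g$ in $G$. Then either $g^s=m^k\neq e$ for some $k,s\in\mathbb{N}$, or $\gcd(o(m),o(g))=1$.
   Context: $G$ acts "without fixed points except the origin" means: for every $g\in G$ with $g\neq e$ and every $v\in\mathbb{H}$, $gv=v$ implies $v=0$. $o(g)$ denotes the order of $g$, and $e$ the identity of $G$. *)

theory Defs
  imports
    "HOL-Analysis.Analysis"
    "HOL-Algebra.Group_Action"
    "HOL-Algebra.Multiplicative_Group"
begin

text \<open>
  A Hilbert space is a type of sort \<open>{real_inner, complete_space}\<close>. Complex Hilbert spaces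
  are covered by restriction of scalars: with the inner product \<open>Re \<langle>x, y\<rangle>\<close> such a space is
  a real Hilbert space with the same norm, and its continuous complex-linear maps are
  continuous real-linear maps.
\<close>

definition centralizer :: "('g, 'b) monoid_scheme \<Rightarrow> 'g \<Rightarrow> 'g set" where
  "centralizer G g = {m \<in> carrier G. m \<otimes>\<^bsub>G\<^esub> g = g \<otimes>\<^bsub>G\<^esub> m}"

definition finite_order :: "('g, 'b) monoid_scheme \<Rightarrow> 'g \<Rightarrow> bool" where
  "finite_order G g \<longleftrightarrow> (\<exists>n::nat. n > 0 \<and> g [^]\<^bsub>G\<^esub> n = \<one>\<^bsub>G\<^esub>)"

text \<open>
  The locale \<open>group_action\<close> makes \<open>\<phi>\<close> a homomorphism from \<open>G\<close> to the group of bijections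
  of its second argument, here the whole space \<open>UNIV\<close>.
\<close>

definition fixed_point_free_linear_action ::
    "('g, 'b) monoid_scheme \<Rightarrow>
     ('g \<Rightarrow> 'h::{real_inner, complete_space} \<Rightarrow> 'h) \<Rightarrow> bool" where
  "fixed_point_free_linear_action G \<phi> \<longleftrightarrow>
     group_action G UNIV \<phi> \<and>
     (\<forall>g\<in>carrier G. bounded_linear (\<phi> g)) \<and>
     (\<forall>g\<in>carrier G. g \<noteq> \<one>\<^bsub>G\<^esub> \<longrightarrow> (\<forall>v. \<phi> g v = v \<longrightarrow> v = 0))"

end

theory Submission
  imports Defs
begin

text \<open>
  If \<open>x \<noteq> e\<close> satisfies \<open>x\<^sup>n = e\<close>, then \<open>v + x v + \<dots> + x\<^bsup>n-1\<^esup> v\<close> is fixed by \<open>x\<close>, so in a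
  fixed point free action it vanishes (\<open>sum_orbit_eq_0\<close>). This alone prevents the group from
  containing \<open>\<int>/n \<times> \<int>/n\<close> with \<open>n > 1\<close>: let \<open>a\<close> and \<open>b\<close> commute, let \<open>a\<close> have order \<open>n\<close> and let \<open>b\<^sup>n = e\<close>.
  If no \<open>a\<^sup>j b\<close> were trivial, then each sum \<open>\<Sum>\<^sub>i (a\<^sup>j b)\<^sup>i v\<close> would vanish; adding these over
  \<open>j < n\<close> and exchanging the sums leaves \<open>n v\<close> for \<open>i = 0\<close>, while the term for each
  \<open>0 < i < n\<close> is the orbit sum of \<open>b\<^sup>i v\<close> under \<open>a\<^sup>i \<noteq> e\<close>, hence zero. So \<open>n v = 0\<close> for every
  \<open>v\<close>, which is absurd in a nonzero space. Therefore \<open>b\<close> is a power of \<open>a\<close>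
  (\<open>root_of_one_is_power\<close>).

  For \<open>d = gcd (o(m)) (o(g)) > 1\<close> this applies to \<open>a = g\<^bsup>o(g)/d\<^esup>\<close> and \<open>b = m\<^bsup>o(m)/d\<^esup>\<close>, which
  both have order \<open>d\<close>; then \<open>b\<close> is the required common nontrivial power.
\<close>

lemma action_mult:
  assumes "fixed_point_free_linear_action G \<phi>" "x \<in> carrier G" "y \<in> carrier G"
  shows "\<phi> (x \<otimes>\<^bsub>G\<^esub> y) v = \<phi> x (\<phi> y v)"
  using assms group_action.composition_rule[of G UNIV \<phi> v x y]
  by (auto simp: fixed_point_free_linear_action_def)

lemma action_one:
  assumes "fixed_point_free_linear_action G \<phi>"
  shows "\<phi> \<one>\<^bsub>G\<^esub> v = v"
  using assms group_action.id_eq_one[of G UNIV \<phi>]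
  by (metis fixed_point_free_linear_action_def restrict_UNIV)

lemma sum_orbit_eq_0:
  assumes act: "fixed_point_free_linear_action G \<phi>" and G: "group G"
    and x: "x \<in> carrier G" "x \<noteq> \<one>\<^bsub>G\<^esub>" "x [^]\<^bsub>G\<^esub> (n::nat) = \<one>\<^bsub>G\<^esub>"
  shows "(\<Sum>i<n. \<phi> (x [^]\<^bsub>G\<^esub> i) v) = 0"
proof -
  interpret group G by (rule G)
  let ?f = "\<lambda>i::nat. \<phi> (x [^]\<^bsub>G\<^esub> i) v"
  interpret bounded_linear "\<phi> x"
    using act x by (auto simp: fixed_point_free_linear_action_def)
  have "\<phi> x (\<Sum>i<n. ?f i) = (\<Sum>i<n. ?f (Suc i))"
    using x by (simp only: sum nat_pow_Suc2 action_mult[OF act] nat_pow_closed)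
  also have "\<dots> = (\<Sum>i<n. ?f i)"
    using sum.lessThan_Suc_shift[of ?f n] sum.lessThan_Suc[of ?f n] x(3) by simp
  finally show ?thesis
    using act x by (auto simp: fixed_point_free_linear_action_def)
qed

text \<open>
  The order of \<open>a\<close> may be composite: the only powers of \<open>a\<close> that enter the double sum are
  \<open>a\<^sup>i\<close> with \<open>0 < i < n\<close>, and it is enough that each of them is
  nontrivial and has trivial \<open>n\<close>-th power.
\<close>

lemma root_of_one_is_power:
  fixes \<phi> :: "'g \<Rightarrow> 'h::{real_inner, complete_space} \<Rightarrow> 'h"
  assumes act: "fixed_point_free_linear_action G \<phi>" and G: "group G"
    and nonzero: "\<exists>v::'h. v \<noteq> 0"
    and a: "a \<in> carrier G" and b: "b \<in> carrier G" and comm: "a \<otimes>\<^bsub>G\<^esub> b = b \<otimes>\<^bsub>G\<^esub> a"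
    and n: "group.ord G a = n" "n > 0" and bn: "b [^]\<^bsub>G\<^esub> n = \<one>\<^bsub>G\<^esub>"
  shows "\<exists>s::nat. b = a [^]\<^bsub>G\<^esub> s"
proof -
  interpret group G by (rule G)
  have an: "a [^]\<^bsub>G\<^esub> n = \<one>\<^bsub>G\<^esub>"
    using a n pow_ord_eq_1 by blast
  have "\<exists>j<n. a [^]\<^bsub>G\<^esub> j \<otimes>\<^bsub>G\<^esub> b = \<one>\<^bsub>G\<^esub>"
  proof (rule ccontr)
    assume "\<not> ?thesis"
    then have nontriv: "a [^]\<^bsub>G\<^esub> j \<otimes>\<^bsub>G\<^esub> b \<noteq> \<one>\<^bsub>G\<^esub>" if "j < n" for j
      using that by blast
    have comm_pow: "a [^]\<^bsub>G\<^esub> (j::nat) \<otimes>\<^bsub>G\<^esub> b = b \<otimes>\<^bsub>G\<^esub> a [^]\<^bsub>G\<^esub> j" for j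
      using a b comm by (metis group_commutes_pow)
    have expand: "(a [^]\<^bsub>G\<^esub> j \<otimes>\<^bsub>G\<^esub> b) [^]\<^bsub>G\<^esub> i = (a [^]\<^bsub>G\<^esub> i) [^]\<^bsub>G\<^esub> j \<otimes>\<^bsub>G\<^esub> b [^]\<^bsub>G\<^esub> i"
      for i j :: nat
      using pow_mult_distrib[OF comm_pow] a b by (simp add: nat_pow_pow mult.commute)
    have kill: "(a [^]\<^bsub>G\<^esub> i) [^]\<^bsub>G\<^esub> n = \<one>\<^bsub>G\<^esub>" for i :: nat
      using a an by (metis nat_pow_pow mult.commute nat_pow_one)
    have "v = 0" for v :: 'h
    proof -
      define S where "S = (\<lambda>i::nat. \<Sum>j<n. \<phi> ((a [^]\<^bsub>G\<^esub> j \<otimes>\<^bsub>G\<^esub> b) [^]\<^bsub>G\<^esub> i) v)"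
      have "S 0 = real n *\<^sub>R v"
        by (simp add: S_def action_one[OF act] sum_constant_scaleR)
      moreover have "S i = 0" if i: "i \<in> {..<n} - {0}" for i
      proof -
        have "\<not> n dvd i"
          using i by (auto dest: dvd_imp_le)
        then have "a [^]\<^bsub>G\<^esub> i \<noteq> \<one>\<^bsub>G\<^esub>"
          using pow_eq_id[OF a] n by blast
        then show ?thesis
          using sum_orbit_eq_0[OF act G _ _ kill] a b
          by (simp add: S_def expand action_mult[OF act])
      qed
      ultimately have "(\<Sum>i<n. S i) = real n *\<^sub>R v"
        using n by (simp add: sum.remove[of _ 0])
      moreover have "(\<Sum>i<n. S i) = 0"
      proof -
        have "(\<Sum>i<n. \<phi> ((a [^]\<^bsub>G\<^esub> j \<otimes>\<^bsub>G\<^esub> b) [^]\<^bsub>G\<^esub> i) v) = 0" if "j < n" for j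
          using sum_orbit_eq_0[OF act G _ nontriv[OF that]] a b expand[of j n] kill bn
          by (simp add: an)
        then show ?thesis
          unfolding S_def by (subst sum.swap) simp
      qed
      ultimately show ?thesis
        using n by simp
    qed
    with nonzero show False by blast
  qed
  then obtain j :: nat where j: "a [^]\<^bsub>G\<^esub> j \<otimes>\<^bsub>G\<^esub> b = \<one>\<^bsub>G\<^esub>" by blast
  \<comment> \<open>\<open>a\<^bsup>j(n-1)\<^esup>\<close> is the inverse of \<open>a\<^sup>j\<close>, written with a natural exponent.\<close>
  have "a [^]\<^bsub>G\<^esub> (j * (n - 1)) \<otimes>\<^bsub>G\<^esub> a [^]\<^bsub>G\<^esub> j = a [^]\<^bsub>G\<^esub> (n * j)"
    using a n(2) by (cases n) (auto simp: nat_pow_mult algebra_simps)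
  also have "\<dots> = \<one>\<^bsub>G\<^esub>"
    using a an by (simp flip: nat_pow_pow)
  finally have "b = a [^]\<^bsub>G\<^esub> (j * (n - 1))"
    using j a b by (metis inv_equality inv_inv inv_unique' nat_pow_closed)
  then show ?thesis by blast
qed

theorem proposition6:
  fixes G :: "('g, 'b) monoid_scheme"
    and \<phi> :: "'g \<Rightarrow> 'h::{real_inner, complete_space} \<Rightarrow> 'h"
    and g m :: 'g
  assumes "\<exists>v::'h. v \<noteq> 0"
    and "fixed_point_free_linear_action G \<phi>"
    and "g \<in> carrier G"
    and "finite_order G g"
    and "m \<in> centralizer G g"
    and "finite_order G m"
  shows "(\<exists>(k::nat) (s::nat). g [^]\<^bsub>G\<^esub> s = m [^]\<^bsub>G\<^esub> k \<and> m [^]\<^bsub>G\<^esub> k \<noteq> \<one>\<^bsub>G\<^esub>)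
         \<or> gcd (group.ord G m) (group.ord G g) = 1"
proof -
  have G: "group G"
    using assms(2) group_hom.axioms(1)[OF group_action.group_hom]
    unfolding fixed_point_free_linear_action_def by blast
  interpret group G by (rule G)
  have m: "m \<in> carrier G" and comm: "m \<otimes>\<^bsub>G\<^esub> g = g \<otimes>\<^bsub>G\<^esub> m"
    using assms(5) by (auto simp: centralizer_def)
  have ord_pos: "ord x > 0" if "x \<in> carrier G" "finite_order G x" for x
    using that pow_eq_id by (fastforce simp: finite_order_def intro: Nat.gr0I)
  define d where "d = gcd (ord m) (ord g)"
  show ?thesis
  proof (cases "d = 1")
    case False
    obtain p q where p: "ord g = d * p" and q: "ord m = d * q"
      by (metis d_def dvdE gcd_dvd1 gcd_dvd2)
    have pos: "d > 0" "p > 0" "q > 0"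
      using ord_pos assms(3,4,6) m p q by (metis nat_0_less_mult_iff)+
    have "ord (g [^]\<^bsub>G\<^esub> p) = d"
      using assms(3) p pos by (simp add: ord_pow)
    moreover have "g [^]\<^bsub>G\<^esub> p \<otimes>\<^bsub>G\<^esub> m [^]\<^bsub>G\<^esub> q = m [^]\<^bsub>G\<^esub> q \<otimes>\<^bsub>G\<^esub> g [^]\<^bsub>G\<^esub> p"
      using comm assms(3) m by (metis group_commutes_pow nat_pow_closed)
    moreover have "(m [^]\<^bsub>G\<^esub> q) [^]\<^bsub>G\<^esub> d = \<one>\<^bsub>G\<^esub>"
      using m q pow_ord_eq_1 by (metis nat_pow_pow mult.commute)
    ultimately obtain s :: nat where "m [^]\<^bsub>G\<^esub> q = (g [^]\<^bsub>G\<^esub> p) [^]\<^bsub>G\<^esub> s"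
      using root_of_one_is_power[OF assms(2) G assms(1)] pos assms(3) m
      by (metis nat_pow_closed)
    then have "g [^]\<^bsub>G\<^esub> (p * s) = m [^]\<^bsub>G\<^esub> q"
      using assms(3) by (simp add: nat_pow_pow)
    moreover have "m [^]\<^bsub>G\<^esub> q \<noteq> \<one>\<^bsub>G\<^esub>"
      using pow_eq_id[OF m] q pos False by simp
    ultimately show ?thesis by blast
  qed (simp add: d_def)
qed

end
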